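(* Let $\mathcal G$ be a class of digraphs for which there is a constant $d$ with $\min(\Delta^-(G),\Delta^+(G))\le d$ for all $G\in\mathcal G$. Then $\mathrm{d\text{-}cutw}$ and $\mathrm{d\text{-}pw}$ are linearly equivalent on $\mathcal G$: there exist linear functions $f_1,f_2$ such that for every $G\in\mathcal G$, $\mathrm{d\text{-}cutw}(G)\le f_1(\mathrm{d\text{-}pw}(G))$ and $\mathrm{d\text{-}pw}(G)\le f_2(\mathrm{d\text{-}cutw}(G))$.
   Context: Digraphs $G=(V,E)$ are finite with $E\subseteq\{(u,v):u\ne v\}$; $\Delta^+(G)$ and $\Delta^-(G)$ denote the maximum out-degree and maximum in-degree. A layout is a bijection $\varphi:V\to\{1,\dots,|V|\}$; $L(i,\varphi)=\{u:\varphi(u)\le i\}$, $R(i,\varphi)=\{u:\varphi(u)>i\}$. $\mathrm{d\text{-}pw}(G)$ is the minimum of $\max|X_i|-1$ over sequences $(X_1,\dots,X_r)$ of subsets of $V$ with $\bigcup X_i=V$, for each $(u,v)\in E$ some $i\le j$ with $u\in X_i,v\in X_j$, and $X_i\cap X_\ell\subseteq X_j$ for $i<j<\ell$. $\mathrm{d\text{-}cutw}(G)=\min_\varphi\max_i|\{(u,v)\in E:u\in L(i,\varphi),v\in R(i,\varphi)\}|$. *)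

theory Defs
  imports Complex_Main "Graph_Theory.Pair_Digraph"
begin

text \<open>A digraph is a record \<open>'a pair_pre_digraph\<close> satisfying the locale predicate
  \<open>pair_digraph\<close>: a finite vertex set \<open>pverts G\<close> and a set \<open>parcs G\<close> of ordered pairs of
  distinct vertices. The vertex set may be empty; the inserted \<open>0\<close> below gives such a digraph
  maximum degree \<open>0\<close> and is redundant otherwise.\<close>

definition max_out_degree :: "'a pair_pre_digraph \<Rightarrow> nat" where
  "max_out_degree G = Max (insert 0 (out_degree (with_proj G) ` pverts G))"

definition max_in_degree :: "'a pair_pre_digraph \<Rightarrow> nat" where
  "max_in_degree G = Max (insert 0 (in_degree (with_proj G) ` pverts G))"

definition is_layout :: "'a pair_pre_digraph \<Rightarrow> ('a \<Rightarrow> nat) \<Rightarrow> bool" where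
  "is_layout G \<phi> \<longleftrightarrow> bij_betw \<phi> (pverts G) {1..card (pverts G)}"

definition layout_left :: "'a pair_pre_digraph \<Rightarrow> nat \<Rightarrow> ('a \<Rightarrow> nat) \<Rightarrow> 'a set" where
  "layout_left G i \<phi> = {u \<in> pverts G. \<phi> u \<le> i}"

definition layout_right :: "'a pair_pre_digraph \<Rightarrow> nat \<Rightarrow> ('a \<Rightarrow> nat) \<Rightarrow> 'a set" where
  "layout_right G i \<phi> = {u \<in> pverts G. \<phi> u > i}"

text \<open>The position \<open>i = 0\<close>, whose cut is empty, only serves to keep the range of the maximum
  nonempty when there are no vertices.\<close>

definition layout_cutwidth :: "'a pair_pre_digraph \<Rightarrow> ('a \<Rightarrow> nat) \<Rightarrow> nat" where
  "layout_cutwidth G \<phi> = Max ((\<lambda>i. card {(u, v) \<in> parcs G.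
      u \<in> layout_left G i \<phi> \<and> v \<in> layout_right G i \<phi>}) ` {0..card (pverts G)})"

definition d_cutw :: "'a pair_pre_digraph \<Rightarrow> nat" where
  "d_cutw G = (INF \<phi>\<in>Collect (is_layout G). layout_cutwidth G \<phi>)"

definition is_path_decomp :: "'a pair_pre_digraph \<Rightarrow> 'a set list \<Rightarrow> bool" where
  "is_path_decomp G Xs \<longleftrightarrow>
     Xs \<noteq> [] \<and>
     (\<forall>X\<in>set Xs. X \<subseteq> pverts G) \<and>
     \<Union>(set Xs) = pverts G \<and>
     (\<forall>(u, v)\<in>parcs G. \<exists>i j. i \<le> j \<and> j < length Xs \<and> u \<in> Xs ! i \<and> v \<in> Xs ! j) \<and>
     (\<forall>i j l. i < j \<longrightarrow> j < l \<longrightarrow> l < length Xs \<longrightarrow> Xs ! i \<inter> Xs ! l \<subseteq> Xs ! j)"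

text \<open>Integer-valued, so that the subtraction is not truncated: the digraph without vertices
  has directed path-width \<open>-1\<close>.\<close>

definition path_decomp_width :: "'a set list \<Rightarrow> int" where
  "path_decomp_width Xs = Max ((\<lambda>X. int (card X)) ` set Xs) - 1"

definition d_pw :: "'a pair_pre_digraph \<Rightarrow> int" where
  "d_pw G = (INF Xs\<in>Collect (is_path_decomp G). path_decomp_width Xs)"

text \<open>Linear in the sense of a polynomial of degree at most one, so a constant term is allowed;
  this is not the library's predicate \<open>linear\<close>.\<close>

definition linear_function :: "(real \<Rightarrow> real) \<Rightarrow> bool" where
  "linear_function f \<longleftrightarrow> (\<exists>a b. \<forall>x. f x = a * x + b)"

text \<open>Both infima are attained minima.\<close>

lemma d_cutw_attained:
  assumes "finite (pverts G)"
  shows "\<exists>\<phi>. is_layout G \<phi> \<and> d_cutw G = layout_cutwidth G \<phi>"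
    and "is_layout G \<phi> \<Longrightarrow> d_cutw G \<le> layout_cutwidth G \<phi>"
proof -
  obtain \<psi> where "bij_betw \<psi> (pverts G) {1..card (pverts G)}"
    using assms finite_same_card_bij[of "pverts G" "{1..card (pverts G)}"] by auto
  then have "layout_cutwidth G ` Collect (is_layout G) \<noteq> {}"
    by (auto simp: is_layout_def)
  from Inf_nat_def1[OF this]
  show "\<exists>\<phi>. is_layout G \<phi> \<and> d_cutw G = layout_cutwidth G \<phi>"
    unfolding d_cutw_def by blast
  show "is_layout G \<phi> \<Longrightarrow> d_cutw G \<le> layout_cutwidth G \<phi>"
    unfolding d_cutw_def by (rule cINF_lower) auto
qed

lemma d_pw_attained:
  assumes "pair_digraph G"
  shows "\<exists>Xs. is_path_decomp G Xs \<and> d_pw G = path_decomp_width Xs"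
    and "is_path_decomp G Xs \<Longrightarrow> d_pw G \<le> path_decomp_width Xs"
proof -
  interpret pair_digraph G by fact
  let ?S = "path_decomp_width ` Collect (is_path_decomp G)"
  have "is_path_decomp G [pverts G]"
    by (auto simp: is_path_decomp_def dest: in_arcsD1 in_arcsD2)
  then have ne: "?S \<noteq> {}" by blast
  have lower: "- 1 \<le> path_decomp_width Xs" if "is_path_decomp G Xs" for Xs
  proof -
    have "Xs \<noteq> []" using that by (simp add: is_path_decomp_def)
    then have "int (card (hd Xs)) \<le> Max ((\<lambda>X. int (card X)) ` set Xs)"
      by (intro Max_ge) auto
    then show ?thesis by (simp add: path_decomp_width_def)
  qed
  then have bdd: "bdd_below ?S" by (auto intro!: bdd_belowI[of _ "- 1"])
  have "\<not> Inf ?S + 1 \<le> Inf ?S" by simp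
  then have "\<exists>x\<in>?S. x < Inf ?S + 1"
    using cInf_greatest[OF ne, of "Inf ?S + 1"] by (meson not_le)
  then obtain Ys where Ys: "is_path_decomp G Ys" "path_decomp_width Ys \<le> Inf ?S"
    by auto
  moreover have "Inf ?S \<le> path_decomp_width Ys"
    using Ys(1) bdd by (intro cINF_lower) auto
  ultimately show "\<exists>Xs. is_path_decomp G Xs \<and> d_pw G = path_decomp_width Xs"
    unfolding d_pw_def by (intro exI[of _ Ys]) simp
  show "is_path_decomp G Xs \<Longrightarrow> d_pw G \<le> path_decomp_width Xs"
    unfolding d_pw_def using bdd by (intro cINF_lower) auto
qed

end

theory Submission
  imports Defs
begin

text \<open>Cuts count arcs from left to right, whereas a path-decomposition constrains only arcs
  going from right to left, so layouts and decompositions are related by reversal.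

  From a layout, the bag at position \<open>i\<close> consists of the \<open>i\<close>-th vertex and the tails of the arcs
  that cross the cut just before \<open>i\<close>; reading the bags from right to left gives a path-decomposition,
  whence d-pw \<open>\<le>\<close> d-cutw.

  Conversely, let \<open>[l(u), r(u)]\<close> be the interval of bags containing \<open>u\<close>, so that every arc
  \<open>(u, v)\<close> satisfies \<open>l(u) \<le> r(v)\<close>. Ordering the vertices by decreasing \<open>l\<close>, an arc \<open>(u, v)\<close> that
  crosses a cut satisfies \<open>l(v) \<le> t \<le> l(u) \<le> r(v)\<close> for a \<open>t\<close> depending only on the cut, hence its
  head lies in the \<open>t\<close>-th bag. With decreasing \<open>r\<close> its tail does. Bounded in-degree or
  out-degree therefore gives d-cutw \<open>\<le> d\<close> (d-pw \<open>+ 1\<close>).\<close>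

section \<open>Layouts sorted by a vertex key\<close>

lemma ex_layout_decreasing_key:
  fixes f :: "'a \<Rightarrow> nat"
  assumes "finite V"
  shows "\<exists>\<phi>. bij_betw \<phi> V {1..card V} \<and> (\<forall>u\<in>V. \<forall>v\<in>V. \<phi> u < \<phi> v \<longrightarrow> f v \<le> f u)"
  using assms
proof (induction V rule: finite_psubset_induct)
  case (psubset V)
  show ?case
  proof (cases "V = {}")
    case False
    \<comment> \<open>The vertex of least key takes the last position and the rest is laid out by
      induction. Ties may be broken arbitrarily, as keys are compared weakly.\<close>
    obtain x where x: "x \<in> V" "\<And>y. y \<in> V \<Longrightarrow> f x \<le> f y"
      using arg_min_if_finite[OF psubset.hyps(1) False, of f] by (metis not_le_imp_less)
    define W where "W = V - {x}"
    have V: "V = insert x W" "x \<notin> W" "finite W" "W \<subset> V"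
      using x(1) psubset.hyps(1) by (auto simp: W_def)
    obtain \<phi> where \<phi>: "bij_betw \<phi> W {1..card W}"
      "\<forall>u\<in>W. \<forall>v\<in>W. \<phi> u < \<phi> v \<longrightarrow> f v \<le> f u"
      using psubset.IH[OF V(4)] by blast
    define \<psi> where "\<psi> = \<phi>(x := Suc (card W))"
    have "bij_betw \<psi> W {1..card W}"
      using \<phi>(1) V(2) by (subst bij_betw_cong[of _ _ \<phi>]) (auto simp: \<psi>_def)
    then have "bij_betw \<psi> (insert x W) (insert (\<psi> x) {1..card W})"
      using V(2) by (subst notIn_Un_bij_betw3[of x W \<psi>, simplified, symmetric])
        (auto simp: \<psi>_def)
    moreover have "insert (\<psi> x) {1..card W} = {1..card V}"
      using V(1-3) by (auto simp: \<psi>_def)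
    moreover have "\<phi> u \<le> card W" if "u \<in> W" for u
      using bij_betwE[OF \<phi>(1)] that by auto
    then have "f v \<le> f u" if "u \<in> V" "v \<in> V" "\<psi> u < \<psi> v" for u v
      using \<phi>(2) V(1,2) x(2)[OF that(1)] that
      by (cases "u = x"; cases "v = x") (auto simp: \<psi>_def dest: le_imp_less_Suc less_asym)
    ultimately show ?thesis
      using V(1) by auto
  qed (auto simp: bij_betw_def)
qed

text \<open>In a layout by decreasing key, the least key on the left of a cut is a threshold
  \<open>t\<close> between the two sides, so every crossing arc is among those counted in
  \<open>cut\<close>. Both comparisons with \<open>t\<close> are weak because equal keys may occur
  on both sides.\<close>

lemma d_cutw_le_key_cuts:
  fixes f :: "'a \<Rightarrow> nat"
  assumes "pair_digraph G"
    and cut: "\<And>t. card {(u, v) \<in> parcs G. f v \<le> t \<and> t \<le> f u} \<le> c"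
  shows "d_cutw G \<le> c"
proof -
  interpret pair_digraph G by fact
  obtain \<phi> where bij: "bij_betw \<phi> (pverts G) {1..card (pverts G)}"
    and dec: "\<And>u v. u \<in> pverts G \<Longrightarrow> v \<in> pverts G \<Longrightarrow> \<phi> u < \<phi> v \<Longrightarrow> f v \<le> f u"
    using ex_layout_decreasing_key[of "pverts G" f] by auto
  have lay: "is_layout G \<phi>"
    using bij by (simp add: is_layout_def)
  have "card {(u, v) \<in> parcs G. u \<in> layout_left G i \<phi> \<and> v \<in> layout_right G i \<phi>} \<le> c"
    (is "card ?A \<le> c") for i
  \<comment> \<open>An empty left side offers no key for \<open>t\<close>, but then no arc crosses
    either.\<close>
  proof (cases "layout_left G i \<phi> = {}")
    case False
    define t where "t = Min (f ` layout_left G i \<phi>)"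
    have fin: "finite (layout_left G i \<phi>)"
      by (simp add: layout_left_def)
    then have "t \<in> f ` layout_left G i \<phi>"
      unfolding t_def using False by (intro Min_in) auto
    then obtain w where w: "w \<in> layout_left G i \<phi>" "f w = t" by blast
    have "?A \<subseteq> {(u, v) \<in> parcs G. f v \<le> t \<and> t \<le> f u}"
    proof clarify
      fix u v
      assume u: "u \<in> layout_left G i \<phi>" and v: "v \<in> layout_right G i \<phi>"
      \<comment> \<open>\<open>w\<close> attains the least key on the left and precedes every vertex
        on the right.\<close>
      have "f v \<le> f w"
        using w(1) v by (intro dec) (auto simp: layout_left_def layout_right_def)
      moreover have "t \<le> f u"
        unfolding t_def using fin u by auto
      ultimately show "f v \<le> t \<and> t \<le> f u"
        using w(2) by simp
    qed
    then have "card ?A \<le> card {(u, v) \<in> parcs G. f v \<le> t \<and> t \<le> f u}"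
      by (intro card_mono finite_subset[OF _ finite_arcs]) auto
    then show ?thesis
      using cut[of t] by linarith
  qed simp
  then have "layout_cutwidth G \<phi> \<le> c"
    unfolding layout_cutwidth_def by (subst Max_le_iff) auto
  then show ?thesis
    using d_cutw_attained(2)[OF finite_verts lay] by linarith
qed

section \<open>Directed cut-width bounded by degree and directed path-width\<close>

lemma card_arcs_heads_le:
  assumes "pair_digraph G" "S \<subseteq> pverts G"
  shows "card {(u, v) \<in> parcs G. v \<in> S} \<le> card S * max_in_degree G"
proof -
  interpret pair_digraph G by fact
  have "finite S" using assms(2) finite_verts by (rule finite_subset)
  have "{(u, v) \<in> parcs G. v \<in> S} = (\<Union>v\<in>S. in_arcs (with_proj G) v)"
    by (auto simp: in_arcs_def)
  then have "card {(u, v) \<in> parcs G. v \<in> S} \<le> (\<Sum>v\<in>S. in_degree (with_proj G) v)"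
    using card_UN_le[OF \<open>finite S\<close>, of "in_arcs (with_proj G)"] by (simp add: in_degree_def)
  moreover have "in_degree (with_proj G) v \<le> max_in_degree G" if "v \<in> S" for v
    unfolding max_in_degree_def using that assms(2) by (intro Max_ge) auto
  then have "(\<Sum>v\<in>S. in_degree (with_proj G) v) \<le> card S * max_in_degree G"
    using sum_bounded_above[of S "in_degree (with_proj G)" "max_in_degree G"] by simp
  ultimately show ?thesis by linarith
qed

lemma card_arcs_tails_le:
  assumes "pair_digraph G" "S \<subseteq> pverts G"
  shows "card {(u, v) \<in> parcs G. u \<in> S} \<le> card S * max_out_degree G"
proof -
  interpret pair_digraph G by fact
  have "finite S" using assms(2) finite_verts by (rule finite_subset)
  have "{(u, v) \<in> parcs G. u \<in> S} = (\<Union>u\<in>S. out_arcs (with_proj G) u)"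
    by (auto simp: out_arcs_def)
  then have "card {(u, v) \<in> parcs G. u \<in> S} \<le> (\<Sum>u\<in>S. out_degree (with_proj G) u)"
    using card_UN_le[OF \<open>finite S\<close>, of "out_arcs (with_proj G)"] by (simp add: out_degree_def)
  moreover have "out_degree (with_proj G) v \<le> max_out_degree G" if "v \<in> S" for v
    unfolding max_out_degree_def using that assms(2) by (intro Max_ge) auto
  then have "(\<Sum>v\<in>S. out_degree (with_proj G) v) \<le> card S * max_out_degree G"
    using sum_bounded_above[of S "out_degree (with_proj G)" "max_out_degree G"] by simp
  ultimately show ?thesis by linarith
qed

text \<open>The bags containing a vertex are consecutive, so the first and last of their indices
  serve as \<open>l\<close> and \<open>r\<close>. If bags \<open>i \<le> j\<close> witness an arc
  \<open>(u, v)\<close>, then \<open>l u \<le> i \<le> j \<le> r v\<close>.\<close>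

lemma path_decomp_intervals:
  assumes "is_path_decomp G Xs"
  obtains l r :: "'a \<Rightarrow> nat" where
    "\<And>u t. u \<in> pverts G \<Longrightarrow> l u \<le> t \<Longrightarrow> t \<le> r u \<Longrightarrow> t < length Xs \<and> u \<in> Xs ! t"
    "\<And>u v. (u, v) \<in> parcs G \<Longrightarrow> l u \<le> r v"
proof -
  define I where "I u = {i. i < length Xs \<and> u \<in> Xs ! i}" for u
  have fin: "finite (I u)" for u by (simp add: I_def)
  have ne: "I u \<noteq> {}" if "u \<in> pverts G" for u
  proof -
    have "u \<in> \<Union>(set Xs)" using assms that by (simp add: is_path_decomp_def)
    then show ?thesis by (auto simp: I_def in_set_conv_nth)
  qed
  show thesis
  proof (rule that[of "\<lambda>u. Min (I u)" "\<lambda>u. Max (I u)"])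
    fix u t
    assume u: "u \<in> pverts G" and t: "Min (I u) \<le> t" "t \<le> Max (I u)"
    have ends: "Min (I u) \<in> I u" "Max (I u) \<in> I u"
      using fin ne[OF u] by auto
    have "t \<in> I u"
    \<comment> \<open>The condition on intersections of bags concerns strictly intermediate indices
      only, so the ends are treated apart.\<close>
    proof (cases "t = Min (I u) \<or> t = Max (I u)")
      case False
      then have "Min (I u) < t" "t < Max (I u)" "Max (I u) < length Xs"
        using t ends by (auto simp: I_def)
      then have "Xs ! Min (I u) \<inter> Xs ! Max (I u) \<subseteq> Xs ! t"
        using assms by (simp add: is_path_decomp_def)
      then show ?thesis
        using ends \<open>t < Max (I u)\<close> by (auto simp: I_def)
    qed (use ends in auto)
    then show "t < length Xs \<and> u \<in> Xs ! t" by (simp add: I_def)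
  next
    fix u v
    assume "(u, v) \<in> parcs G"
    then obtain i j where "i \<le> j" "j < length Xs" "u \<in> Xs ! i" "v \<in> Xs ! j"
      using assms by (fastforce simp: is_path_decomp_def)
    then have "i \<in> I u" "j \<in> I v" by (auto simp: I_def)
    then show "Min (I u) \<le> Max (I v)"
      using \<open>i \<le> j\<close> fin by (meson Max_ge Min_le order_trans)
  qed
qed

lemma d_cutw_le_d_pw:
  assumes G: "pair_digraph G"
  shows "int (d_cutw G) \<le> int (min (max_in_degree G) (max_out_degree G)) * (d_pw G + 1)"
proof -
  interpret pair_digraph G by fact
  obtain Xs where Xs: "is_path_decomp G Xs" "d_pw G = path_decomp_width Xs"
    using d_pw_attained(1)[OF G] by blast
  define k where "k = Max (card ` set Xs)"
  have "Xs \<noteq> []" and sub: "\<And>X. X \<in> set Xs \<Longrightarrow> X \<subseteq> pverts G"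
    using Xs(1) by (auto simp: is_path_decomp_def)
  have "int k = Max (int ` card ` set Xs)"
    unfolding k_def using \<open>Xs \<noteq> []\<close> by (intro mono_Max_commute) (auto simp: mono_def)
  then have pw: "d_pw G + 1 = int k"
    using Xs(2) by (simp add: path_decomp_width_def image_image)
  have bag: "card X \<le> k" if "X \<in> set Xs" for X
    unfolding k_def using that by (intro Max_ge) auto
  obtain l r where
    lr: "\<And>u t. u \<in> pverts G \<Longrightarrow> l u \<le> t \<Longrightarrow> t \<le> r u \<Longrightarrow> t < length Xs \<and> u \<in> Xs ! t"
    and arc: "\<And>u v. (u, v) \<in> parcs G \<Longrightarrow> l u \<le> r v"
    using path_decomp_intervals[OF Xs(1)] by blast
  have "d_cutw G \<le> k * max_in_degree G"
  proof (rule d_cutw_le_key_cuts[OF G, of l])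
    fix t
    let ?A = "{(u, v) \<in> parcs G. l v \<le> t \<and> t \<le> l u}"
    have head: "t < length Xs \<and> v \<in> Xs ! t" if "(u, v) \<in> ?A" for u v
      using that arc[of u v] by (intro lr) (auto dest: in_arcsD2)
    show "card ?A \<le> k * max_in_degree G"
    \<comment> \<open>The threshold \<open>t\<close> is an arbitrary natural number; past the last
      bag, \<open>head\<close> leaves no arc to count.\<close>
    proof (cases "t < length Xs")
      case True
      then have "card ?A \<le> card {(u, v) \<in> parcs G. v \<in> Xs ! t}"
        using head by (intro card_mono finite_subset[OF _ finite_arcs]) auto
      also have "\<dots> \<le> card (Xs ! t) * max_in_degree G"
        using sub True by (intro card_arcs_heads_le[OF G]) simp
      also have "\<dots> \<le> k * max_in_degree G"
        using bag True by (intro mult_le_mono1) simp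
      finally show ?thesis .
    next
      case False
      then have "?A = {}" using head by blast
      then show ?thesis by (metis card.empty le0)
    qed
  qed
  moreover have "d_cutw G \<le> k * max_out_degree G"
  proof (rule d_cutw_le_key_cuts[OF G, of r])
    fix t
    let ?A = "{(u, v) \<in> parcs G. r v \<le> t \<and> t \<le> r u}"
    \<comment> \<open>Here the chain is \<open>l u \<le> r v \<le> t \<le> r u\<close>, which places
      \<open>t\<close> in the interval of the tail.\<close>
    have tail: "t < length Xs \<and> u \<in> Xs ! t" if "(u, v) \<in> ?A" for u v
      using that arc[of u v] by (intro lr) (auto dest: in_arcsD1)
    show "card ?A \<le> k * max_out_degree G"
    proof (cases "t < length Xs")
      case True
      then have "card ?A \<le> card {(u, v) \<in> parcs G. u \<in> Xs ! t}"
        using tail by (intro card_mono finite_subset[OF _ finite_arcs]) auto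
      also have "\<dots> \<le> card (Xs ! t) * max_out_degree G"
        using sub True by (intro card_arcs_tails_le[OF G]) simp
      also have "\<dots> \<le> k * max_out_degree G"
        using bag True by (intro mult_le_mono1) simp
      finally show ?thesis .
    next
      case False
      then have "?A = {}" using tail by blast
      then show ?thesis by (metis card.empty le0)
    qed
  qed
  ultimately have "d_cutw G \<le> min (max_in_degree G) (max_out_degree G) * k"
    by (simp add: min_def mult.commute)
  then show ?thesis
    unfolding pw by (metis of_nat_le_iff of_nat_mult)
qed

section \<open>Directed path-width bounded by directed cut-width\<close>

lemma d_pw_le_d_cutw:
  assumes G: "pair_digraph G"
  shows "d_pw G \<le> int (d_cutw G)"
proof -
  interpret pair_digraph G by fact
  obtain \<phi> where \<phi>: "is_layout G \<phi>" "d_cutw G = layout_cutwidth G \<phi>"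
    using d_cutw_attained(1)[OF finite_verts] by blast
  define n where "n = card (pverts G)"
  \<comment> \<open>A vertex stays in the bags from its own position up to that of its furthest
    out-neighbour on the right, if it has one.\<close>
  define B where
    "B i = {u \<in> pverts G. \<phi> u = i \<or> \<phi> u < i \<and> (\<exists>v. (u, v) \<in> parcs G \<and> i \<le> \<phi> v)}" for i
  \<comment> \<open>Position \<open>0\<close> contributes an empty bag, which keeps the list nonempty when \<open>n = 0\<close>.\<close>
  define Xs where "Xs = map (\<lambda>j. B (n - j)) [0..<Suc n]"
  have len: "length Xs = Suc n" by (simp add: Xs_def)
  have nth: "Xs ! j = B (n - j)" if "j \<le> n" for j
    using that unfolding Xs_def by (subst nth_map) (auto simp del: upt_Suc)
  have set: "set Xs = B ` {0..n}"
  proof -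
    have "set Xs = B ` ((\<lambda>j. n - j) ` {0..n})"
      unfolding Xs_def by (auto simp del: upt_Suc)
    also have "(\<lambda>j. n - j) ` {0..n} = {0..n}"
    proof (intro equalityI subsetI)
      fix i assume "i \<in> {0..n}"
      then show "i \<in> (\<lambda>j. n - j) ` {0..n}"
        by (intro image_eqI[of _ _ "n - i"]) auto
    qed auto
    finally show ?thesis .
  qed
  have rng: "\<phi> u \<le> n" and inj: "inj_on \<phi> (pverts G)" if "u \<in> pverts G" for u
    using \<phi>(1) that by (auto simp: is_layout_def n_def bij_betw_def)
  have "is_path_decomp G Xs"
    unfolding is_path_decomp_def
  proof (intro conjI)
    show "Xs \<noteq> []" using len by auto
    show "\<forall>X\<in>set Xs. X \<subseteq> pverts G" by (auto simp: set B_def)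
    show "\<Union>(set Xs) = pverts G"
    proof
      show "pverts G \<subseteq> \<Union>(set Xs)"
      proof
        fix u assume "u \<in> pverts G"
        then have "u \<in> B (\<phi> u)" "\<phi> u \<in> {0..n}"
          using rng by (auto simp: B_def)
        then show "u \<in> \<Union>(set Xs)" unfolding set by blast
      qed
    qed (auto simp: set B_def)
    show "\<forall>(u, v)\<in>parcs G. \<exists>i j. i \<le> j \<and> j < length Xs \<and> u \<in> Xs ! i \<and> v \<in> Xs ! j"
    proof clarify
      fix u v assume uv: "(u, v) \<in> parcs G"
      then have V: "u \<in> pverts G" "v \<in> pverts G" by (auto dest: in_arcsD1 in_arcsD2)
      \<comment> \<open>An arc going right has both ends in the bag at its head's position. For an
        arc going left, the bags at the two end positions serve, in the right order after
        reversal.\<close>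
      define m where "m = max (\<phi> u) (\<phi> v)"
      have "u \<in> B m" "v \<in> B (\<phi> v)" "\<phi> v \<le> m" "m \<le> n"
        using uv V rng by (auto simp: B_def m_def max_def)
      then show "\<exists>i j. i \<le> j \<and> j < length Xs \<and> u \<in> Xs ! i \<and> v \<in> Xs ! j"
        by (intro exI[of _ "n - m"] exI[of _ "n - \<phi> v"]) (auto simp: len nth)
    qed
    show "\<forall>i j l. i < j \<longrightarrow> j < l \<longrightarrow> l < length Xs \<longrightarrow> Xs ! i \<inter> Xs ! l \<subseteq> Xs ! j"
    proof (intro allI impI)
      fix i j l assume ij: "i < j" "j < l" "l < length Xs"
      \<comment> \<open>A vertex of \<open>B c\<close> has position at most \<open>c\<close>; if it
        also lies in \<open>B a\<close>, it has an arc reaching \<open>a\<close> or further, hence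
        beyond \<open>b\<close>.\<close>
      have "B a \<inter> B c \<subseteq> B b" if "c < b" "b < a" for a b c
        using that by (fastforce simp: B_def)
      from this[of "n - l" "n - j" "n - i"] show "Xs ! i \<inter> Xs ! l \<subseteq> Xs ! j"
        using ij by (simp add: len nth)
    qed
  qed
  then have "d_pw G \<le> path_decomp_width Xs"
    by (rule d_pw_attained(2)[OF G])
  also have "\<dots> \<le> int (d_cutw G)"
  proof -
    \<comment> \<open>The extra one accounts for the vertex at position \<open>i\<close> and cancels
      against the \<open>- 1\<close> in the width.\<close>
    have "card (B i) \<le> Suc (d_cutw G)" if "i \<le> n" for i
    proof -
      let ?C = "{(u, v) \<in> parcs G. u \<in> layout_left G (i - 1) \<phi> \<and> v \<in> layout_right G (i - 1) \<phi>}"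
      let ?W = "{u \<in> pverts G. \<phi> u = i}"
      have finC: "finite ?C"
        by (rule finite_subset[OF _ finite_arcs]) auto
      have "card ?W \<le> 1"
        using inj by (intro card_le_Suc0_iff_eq[THEN iffD2, folded One_nat_def])
          (auto dest: inj_onD)
      moreover have "B i \<subseteq> ?W \<union> fst ` ?C"
      proof
        fix u assume u: "u \<in> B i"
        show "u \<in> ?W \<union> fst ` ?C"
        proof (cases "\<phi> u = i")
          case False
          then obtain v where v: "(u, v) \<in> parcs G" "\<phi> u < i" "i \<le> \<phi> v"
            using u by (auto simp: B_def)
          \<comment> \<open>Since \<open>\<phi> u < i\<close> forces \<open>i > 0\<close>, the
            subtraction in \<open>i - 1\<close> is not truncated here.\<close>
          then have "(u, v) \<in> ?C"
            by (auto simp: layout_left_def layout_right_def dest: in_arcsD1 in_arcsD2)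
          then show ?thesis by force
        qed (use u in \<open>auto simp: B_def\<close>)
      qed
      then have "card (B i) \<le> card (?W \<union> fst ` ?C)"
        using finC by (intro card_mono) auto
      \<comment> \<open>Several crossing arcs may share a tail, so projecting to tails can only
        lower the count.\<close>
      then have "card (B i) \<le> card ?W + card ?C"
        using card_Un_le[of ?W "fst ` ?C"] card_image_le[OF finC, of fst] by linarith
      moreover have "card ?C \<le> layout_cutwidth G \<phi>"
        unfolding layout_cutwidth_def using that by (intro Max_ge) (auto simp: n_def)
      ultimately show ?thesis
        using \<phi>(2) by linarith
    qed
    then have "Max ((\<lambda>X. int (card X)) ` set Xs) \<le> int (Suc (d_cutw G))"
      by (subst Max_le_iff) (auto simp: set simp del: of_nat_Suc)
    then show ?thesis by (simp add: path_decomp_width_def)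
  qed
  finally show ?thesis .
qed

section \<open>Linear equivalence\<close>

theorem theorem5p12:
  fixes \<G> :: "'a pair_pre_digraph set"
  assumes "\<And>G. G \<in> \<G> \<Longrightarrow> pair_digraph G"
    and "\<exists>d::nat. \<forall>G\<in>\<G>. min (max_in_degree G) (max_out_degree G) \<le> d"
  shows "\<exists>f1 f2 :: real \<Rightarrow> real. linear_function f1 \<and> linear_function f2 \<and>
           (\<forall>G\<in>\<G>. real (d_cutw G) \<le> f1 (real_of_int (d_pw G)) \<and>
                   real_of_int (d_pw G) \<le> f2 (real (d_cutw G)))"
proof -
  obtain d :: nat where d: "\<And>G. G \<in> \<G> \<Longrightarrow> min (max_in_degree G) (max_out_degree G) \<le> d"
    using assms(2) by blast
  have upper: "real (d_cutw G) \<le> real d * real_of_int (d_pw G) + real d" if "G \<in> \<G>" for G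
  proof -
    note G = assms(1)[OF that]
    \<comment> \<open>Replacing the smaller degree by \<open>d\<close> requires a nonnegative factor
      \<open>d_pw G + 1\<close>; bag sizes provide this even when the width is
      \<open>-1\<close>.\<close>
    obtain Xs where "is_path_decomp G Xs" "d_pw G = path_decomp_width Xs"
      using d_pw_attained(1)[OF G] by blast
    moreover from this have "int (card (hd Xs)) \<le> Max ((\<lambda>X. int (card X)) ` set Xs)"
      by (intro Max_ge) (auto simp: is_path_decomp_def)
    ultimately have "0 \<le> d_pw G + 1"
      by (simp add: path_decomp_width_def)
    then have "int (d_cutw G) \<le> int d * (d_pw G + 1)"
      using d_cutw_le_d_pw[OF G] d[OF that]
      by (meson mult_right_mono of_nat_mono order_trans)
    then have "real_of_int (int (d_cutw G)) \<le> real_of_int (int d * (d_pw G + 1))"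
      by (simp only: of_int_le_iff)
    then show ?thesis by (simp add: algebra_simps)
  qed
  have lower: "real_of_int (d_pw G) \<le> real (d_cutw G)" if "G \<in> \<G>" for G
    using d_pw_le_d_cutw[OF assms(1)[OF that]] by linarith
  have "linear_function (\<lambda>x. real d * x + real d)" "linear_function (\<lambda>x. x)"
    unfolding linear_function_def
    by (auto intro: exI[of _ "real d"] exI[of _ 1] exI[of _ 0])
  with upper lower show ?thesis by blast
qed

end
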